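(* Let $\alpha\in(0,1)$, let $\Theta_0\subseteq\Theta$, and consider testing $\mathrm H_0:\theta\in\Theta_0$ against $\mathrm H_1:\theta\in\Theta\setminus\Theta_0$ with sequentially arriving i.i.d. data $X_1,X_2,\dots$. The running composite likelihood ratio test rejects $\mathrm H_0$ and stops at the first time $n$ at which $M_{\boldsymbol\alpha,\boldsymbol\beta,n}>1/\alpha$. For data i.i.d. from $\mathcal P_\theta$, let $$\nu_\theta=\inf\{n\in\mathbb N: M_{\boldsymbol\alpha,\boldsymbol\beta,n}>1/\alpha\}\in\mathbb N\cup\{\infty\}$$ be the time at which the test stops. Then the running test has Type I error at most $\alpha$; that is, $$\sup_{\theta^*\in\Theta_0}\mathrm{Pr}_{\theta^*}(\nu_{\theta^*}<\infty)\le\alpha .$$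
   Context: Model. $d,q\in\mathbb N$, $\mathbb X\subseteq\mathbb R^d$, $\Theta\subseteq\mathbb R^q$. $\{\mathcal P_\theta:\theta\in\Theta\}$ is a parametric family of distributions on $\mathbb X$ with probability density or mass functions $p(x;\theta)$ ("PDF" means PDF or PMF throughout). $\mathrm{Pr}_{\theta^*}$ is probability when the data $X_1,X_2,\dots$ are i.i.d. from $\mathcal P_{\theta^*}$, i.e. with PDF $p(x;\theta^* )$. Index sets. $[d]=\{1,\dots,d\}$; $\mathbb S_d$ is the set of all non-empty subsets of $[d]$; $\mathbb T_d$ is the set of all ordered pairs $T=(\overleftarrow T,\overrightarrow T)$ of disjoint non-empty subsets of $[d]$ (their union need not be $[d]$; so $|\mathbb T_d|=3^d-2^{d+1}+1$). For $x\in\mathbb R^d$ and $S\subseteq[d]$, $x_S$ is the subvector of coordinates indexed by $S$. $p(x_S;\theta)$ denotes the marginal PDF of $X_S$ and $p(x_{\overleftarrow T}\mid x_{\overrightarrow T};\theta)$ the conditional PDF of $X_{\overleftarrow T}$ given $X_{\overrightarrow T}=x_{\overrightarrow T}$ when $X\sim\mathcal P_\theta$ (a fixed version, which is a PDF in $x_{\overleftarrow T}$ for each $x_{\overrightarrow T}$). Composite likelihood. Fixed weights $\alpha_S\ge0$ ($S\in\mathbb S_d$), $\beta_T\ge0$ ($T\in\mathbb T_d$), collected in $\boldsymbol\alpha=(\alpha_S)_{S}$, $\boldsymbol\beta=(\beta_T)_{T}$, satisfy $\gamma=\sum_{S\in\mathbb S_d}\alpha_S+\sum_{T\in\mathbb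 T_d}\beta_T>0$. The individual composite likelihood is $$p_{\boldsymbol\alpha,\boldsymbol\beta}(x;\theta)=\prod_{S\in\mathbb S_d}[p(x_S;\theta)]^{\alpha_S/\gamma}\prod_{T\in\mathbb T_d}[p(x_{\overleftarrow T}\mid x_{\overrightarrow T};\theta)]^{\beta_T/\gamma}$$ (with $0^0=1$). The weights are unrelated to the scalar level $\alpha$. Sequential statistic. Write $\mathbf X_n=(X_1,\dots,X_n)$. For each $n\in\mathbb N$, $\tilde\theta^1_{n-1}$ is an arbitrary $\Theta$-valued non-anticipating estimator, i.e. a (measurable) function of $\mathbf X_{n-1}$ only (so $\tilde\theta^1_0$ is non-random). Let $$\hat\theta_n^0\in\underset{\theta\in\Theta_0}{\arg\max}\;\prod_{i=1}^n p_{\boldsymbol\alpha,\boldsymbol\beta}(X_i;\theta)$$ be the maximum composite likelihood estimator over $\Theta_0$ based on $\mathbf X_n$ (assumed to exist and be measurable). The running test statistic is $$M_{\boldsymbol\alpha,\boldsymbol\beta,n}=\frac{\prod_{i=1}^n p_{\boldsymbol\alpha,\boldsymbol\beta}(X_i;\tilde\theta^1_{i-1})}{\prod_{i=1}^n p_{\boldsymbol\alpha,\boldsymbol\beta}(X_i;\hat\theta^0_n)} .$$ *)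

theory Defs
  imports "HOL-Probability.Probability"
begin

text \<open>
  A point of Euclidean space with coordinates indexed by a finite set \<open>I\<close> of naturals is an extensional
  function on \<open>I\<close>, so the subvector \<open>x\<^sub>S\<close> is \<open>restrict x S\<close>.
\<close>

type_synonym vec = "nat \<Rightarrow> real"

definition euclid :: "nat set \<Rightarrow> vec measure" where
  "euclid I = PiM I (\<lambda>_. borel)"

definition sample_space :: "nat \<Rightarrow> vec set \<Rightarrow> vec measure" where
  "sample_space d \<X> = restrict_space (euclid {1..d}) \<X>"

definition param_space :: "nat \<Rightarrow> vec set \<Rightarrow> vec measure" where
  "param_space q \<Theta> = restrict_space (euclid {1..q}) \<Theta>"

datatype dist_kind = Continuous | Discrete

text \<open>
  Densities are taken with respect to Lebesgue measure, mass functions with respect to counting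
  measure. The latter is put on the Borel sets (not on the full power set), so that both kinds of
  distribution live on the same measurable space; discrete distributions in the family need not
  have a common countable support.
\<close>

fun base_measure :: "dist_kind \<Rightarrow> nat set \<Rightarrow> vec measure" where
  "base_measure Continuous I = PiM I (\<lambda>_. lborel)"
| "base_measure Discrete I = distr (count_space (I \<rightarrow>\<^sub>E UNIV)) (euclid I) (\<lambda>x. x)"

definition is_pdf :: "dist_kind \<Rightarrow> nat set \<Rightarrow> (vec \<Rightarrow> real) \<Rightarrow> bool" where
  "is_pdf k I f \<longleftrightarrow>
     (\<forall>x\<in>space (euclid I). 0 \<le> f x) \<and>
     f \<in> borel_measurable (euclid I) \<and>
     (\<integral>\<^sup>+x. ennreal (f x) \<partial>base_measure k I) = 1"

definition is_marginal_pdf :: "dist_kind \<Rightarrow> vec measure \<Rightarrow> nat set \<Rightarrow> (vec \<Rightarrow> real) \<Rightarrow> bool" where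
  "is_marginal_pdf k P S f \<longleftrightarrow>
     is_pdf k S f \<and> distributed P (base_measure k S) (\<lambda>x. restrict x S) (\<lambda>x. ennreal (f x))"

text \<open>
  \<open>g u v\<close> is a version of the conditional PDF of the \<open>A\<close>-subvector at \<open>u\<close> given that the
  \<open>B\<close>-subvector is \<open>v\<close>; \<open>f\<close> and \<open>h\<close> are the marginal PDFs for \<open>A \<union> B\<close> and for \<open>B\<close>. It has to be a
  PDF in \<open>u\<close> for every possible \<open>v\<close>, also for those with \<open>h v = 0\<close>.
\<close>

definition is_conditional_pdf ::
  "dist_kind \<Rightarrow> vec set \<Rightarrow> nat set \<Rightarrow> nat set \<Rightarrow> (vec \<Rightarrow> real) \<Rightarrow> (vec \<Rightarrow> real)
     \<Rightarrow> (vec \<Rightarrow> vec \<Rightarrow> real) \<Rightarrow> bool" where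
  "is_conditional_pdf k \<X> A B f h g \<longleftrightarrow>
     (\<lambda>x. g (restrict x A) (restrict x B)) \<in> borel_measurable (euclid (A \<union> B)) \<and>
     (\<forall>x\<in>\<X>. is_pdf k A (\<lambda>u. g u (restrict x B))) \<and>
     (AE x in base_measure k (A \<union> B). 0 < h (restrict x B) \<longrightarrow>
        g (restrict x A) (restrict x B) = f x / h (restrict x B))"

definition marginal_indices :: "nat \<Rightarrow> nat set set" where
  "marginal_indices d = {S. S \<subseteq> {1..d} \<and> S \<noteq> {}}"

definition conditional_indices :: "nat \<Rightarrow> (nat set \<times> nat set) set" where
  "conditional_indices d =
     {(A, B). A \<subseteq> {1..d} \<and> B \<subseteq> {1..d} \<and> A \<noteq> {} \<and> B \<noteq> {} \<and> A \<inter> B = {}}"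

text \<open>
  \<open>m S \<theta>\<close> is the PDF of the \<open>S\<close>-subvector under parameter \<open>\<theta>\<close> (for \<open>S = {1..d}\<close> it is the PDF
  \<open>p(\<cdot>;\<theta>)\<close> of the whole observation), and \<open>c (A, B) \<theta>\<close> is the conditional PDF of the
  \<open>A\<close>-subvector given the \<open>B\<close>-subvector.
\<close>

definition parametric_family ::
  "dist_kind \<Rightarrow> nat \<Rightarrow> vec set \<Rightarrow> vec set \<Rightarrow> (vec \<Rightarrow> vec measure)
     \<Rightarrow> (nat set \<Rightarrow> vec \<Rightarrow> vec \<Rightarrow> real)
     \<Rightarrow> (nat set \<times> nat set \<Rightarrow> vec \<Rightarrow> vec \<Rightarrow> vec \<Rightarrow> real) \<Rightarrow> bool" where
  "parametric_family k d \<X> \<Theta> P m c \<longleftrightarrow>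
     (\<forall>\<theta>\<in>\<Theta>.
        prob_space (P \<theta>) \<and> sets (P \<theta>) = sets (sample_space d \<X>) \<and>
        (\<forall>S\<in>marginal_indices d. is_marginal_pdf k (P \<theta>) S (m S \<theta>)) \<and>
        (\<forall>(A, B)\<in>conditional_indices d.
           is_conditional_pdf k \<X> A B (m (A \<union> B) \<theta>) (m B \<theta>) (c (A, B) \<theta>)))"

definition iid_sample :: "'w measure \<Rightarrow> 'a measure \<Rightarrow> (nat \<Rightarrow> 'w \<Rightarrow> 'a) \<Rightarrow> 'a measure \<Rightarrow> bool" where
  "iid_sample M N X \<mu> \<longleftrightarrow>
     prob_space M \<and> prob_space.indep_vars M (\<lambda>_. N) X {1..} \<and> (\<forall>i\<ge>1. distr M N (X i) = \<mu>)"

definition total_weight ::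
  "nat \<Rightarrow> (nat set \<Rightarrow> real) \<Rightarrow> (nat set \<times> nat set \<Rightarrow> real) \<Rightarrow> real" where
  "total_weight d \<alpha> \<beta> = (\<Sum>S\<in>marginal_indices d. \<alpha> S) + (\<Sum>T\<in>conditional_indices d. \<beta> T)"

text \<open>The library has \<open>0 powr 0 = 0\<close>, whereas the composite likelihood needs \<open>0\<^sup>0 = 1\<close>.\<close>

definition pow01 :: "real \<Rightarrow> real \<Rightarrow> real" where
  "pow01 x a = (if a = 0 then 1 else x powr a)"

definition composite_likelihood ::
  "nat \<Rightarrow> (nat set \<Rightarrow> real) \<Rightarrow> (nat set \<times> nat set \<Rightarrow> real)
     \<Rightarrow> (nat set \<Rightarrow> vec \<Rightarrow> vec \<Rightarrow> real)
     \<Rightarrow> (nat set \<times> nat set \<Rightarrow> vec \<Rightarrow> vec \<Rightarrow> vec \<Rightarrow> real)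
     \<Rightarrow> vec \<Rightarrow> vec \<Rightarrow> real" where
  "composite_likelihood d \<alpha> \<beta> m c \<theta> x =
     (\<Prod>S\<in>marginal_indices d. pow01 (m S \<theta> (restrict x S)) (\<alpha> S / total_weight d \<alpha> \<beta>)) *
     (\<Prod>(A, B)\<in>conditional_indices d.
        pow01 (c (A, B) \<theta> (restrict x A) (restrict x B)) (\<beta> (A, B) / total_weight d \<alpha> \<beta>))"

text \<open>
  A data sequence is \<open>x 1, x 2, \<dots>\<close> (the value \<open>x 0\<close> is never used), and an estimator based on the
  first \<open>n\<close> observations is applied to \<open>restrict x {1..n}\<close>.
\<close>

definition running_statistic ::
  "(vec \<Rightarrow> vec \<Rightarrow> real) \<Rightarrow> (nat \<Rightarrow> (nat \<Rightarrow> vec) \<Rightarrow> vec) \<Rightarrow> (nat \<Rightarrow> (nat \<Rightarrow> vec) \<Rightarrow> vec)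
     \<Rightarrow> nat \<Rightarrow> (nat \<Rightarrow> vec) \<Rightarrow> real" where
  "running_statistic L \<theta>\<^sub>1 \<theta>\<^sub>0 n x =
     (\<Prod>i=1..n. L (\<theta>\<^sub>1 (i - 1) (restrict x {1..i - 1})) (x i)) /
     (\<Prod>i=1..n. L (\<theta>\<^sub>0 n (restrict x {1..n})) (x i))"

text \<open>The infimum of the empty set of extended naturals is \<open>\<infinity>\<close>.\<close>

definition rejection_time ::
  "(vec \<Rightarrow> vec \<Rightarrow> real) \<Rightarrow> (nat \<Rightarrow> (nat \<Rightarrow> vec) \<Rightarrow> vec) \<Rightarrow> (nat \<Rightarrow> (nat \<Rightarrow> vec) \<Rightarrow> vec)
     \<Rightarrow> real \<Rightarrow> (nat \<Rightarrow> vec) \<Rightarrow> enat" where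
  "rejection_time L \<theta>\<^sub>1 \<theta>\<^sub>0 a x =
     Inf {enat n | n. 1 \<le> n \<and> running_statistic L \<theta>\<^sub>1 \<theta>\<^sub>0 n x > 1 / a}"

end

theory Submission
  imports Defs
begin

text \<open>
  For \<open>\<theta> \<in> \<Theta>\<^sub>0\<close> the maximum composite likelihood dominates the composite likelihood at \<open>\<theta>\<close>, so the
  running statistic is at most the product of the ratios of the likelihood at the plug-in estimate
  to that at \<open>\<theta>\<close>. By the weighted AM-GM inequality such a ratio is at most a convex combination
  of ratios of marginal and of conditional PDFs, and each of these has expectation at most 1 under
  \<open>\<theta>\<close>. So the product is a nonnegative supermartingale starting at 1, except that it need not be
  measurable: nothing makes the likelihood jointly measurable in the data and the parameter. Ville's
  inequality is therefore proved by integrating out one observation at a time, from the last to the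
  first, which uses measurability of the ratio only in the current observation.
\<close>

subsection \<open>Weighted geometric means\<close>

lemma weighted_am_gm:
  fixes w t :: "'i \<Rightarrow> real"
  assumes "finite I" and w: "\<And>i. i \<in> I \<Longrightarrow> 0 \<le> w i" "(\<Sum>i\<in>I. w i) = 1"
    and t: "\<And>i. i \<in> I \<Longrightarrow> 0 \<le> t i"
  shows "(\<Prod>i\<in>I. pow01 (t i) (w i)) \<le> (\<Sum>i\<in>I. w i * t i)"
proof (cases "\<exists>i\<in>I. w i \<noteq> 0 \<and> t i = 0")
  case True
  then have "\<exists>i\<in>I. pow01 (t i) (w i) = 0"
    by (auto simp: pow01_def)
  then have "(\<Prod>i\<in>I. pow01 (t i) (w i)) = 0"
    using \<open>finite I\<close> by simp
  then show ?thesis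
    using w(1) t by (simp add: sum_nonneg)
next
  case False
  define J where "J = {i\<in>I. w i \<noteq> 0}"
  have J: "J \<subseteq> I" "finite J" and pos: "\<And>i. i \<in> J \<Longrightarrow> 0 < t i"
    using False \<open>finite I\<close> t by (fastforce simp: J_def less_le)+
  have sumJ: "(\<Sum>i\<in>J. w i * f i) = (\<Sum>i\<in>I. w i * f i)" for f
    using \<open>finite I\<close> by (intro sum.mono_neutral_left) (auto simp: J_def)
  have "J \<noteq> {}"
    using sumJ[of "\<lambda>_. 1"] w(2) by auto
  have "(\<Prod>i\<in>I. pow01 (t i) (w i)) = (\<Prod>i\<in>J. t i powr w i)"
    using \<open>finite I\<close> by (intro prod.mono_neutral_cong_right) (auto simp: J_def pow01_def)
  also have "\<dots> = exp (\<Sum>i\<in>J. w i * ln (t i))"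
    using J(2) pos by (subst exp_sum) (auto intro!: prod.cong simp: powr_def dest!: pos)
  also have "\<dots> \<le> (\<Sum>i\<in>J. w i * exp (ln (t i)))"
    using convex_on_sum[OF J(2) \<open>J \<noteq> {}\<close> exp_convex, of w "\<lambda>i. ln (t i)"]
      sumJ[of "\<lambda>_. 1"] w J(1) by auto
  also have "\<dots> = (\<Sum>i\<in>J. w i * t i)"
    by (intro sum.cong) (auto dest!: pos)
  finally show ?thesis
    by (simp add: sumJ)
qed

lemma weighted_am_gm_Plus:
  fixes u s :: "'i \<Rightarrow> real" and v t :: "'j \<Rightarrow> real"
  assumes fin: "finite I" "finite J"
    and u: "\<And>i. i \<in> I \<Longrightarrow> 0 \<le> u i" and v: "\<And>j. j \<in> J \<Longrightarrow> 0 \<le> v j"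
    and one: "(\<Sum>i\<in>I. u i) + (\<Sum>j\<in>J. v j) = 1"
    and s: "\<And>i. i \<in> I \<Longrightarrow> 0 \<le> s i" and t: "\<And>j. j \<in> J \<Longrightarrow> 0 \<le> t j"
  shows "(\<Prod>i\<in>I. pow01 (s i) (u i)) * (\<Prod>j\<in>J. pow01 (t j) (v j))
    \<le> (\<Sum>i\<in>I. u i * s i) + (\<Sum>j\<in>J. v j * t j)"
proof -
  have "(\<Prod>i\<in>I <+> J. pow01 (case_sum s t i) (case_sum u v i))
      \<le> (\<Sum>i\<in>I <+> J. case_sum u v i * case_sum s t i)"
    using assms by (intro weighted_am_gm) (auto simp: sum.Plus comp_def)
  then show ?thesis
    using fin by (simp add: prod.Plus sum.Plus comp_def)
qed

lemma pow01_divide: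
  assumes "0 \<le> x" "0 \<le> y"
  shows "pow01 (x / y) w = pow01 x w / pow01 y w"
  using assms by (simp add: pow01_def powr_divide)

lemma pow01_nonneg: "0 \<le> pow01 x w"
  by (simp add: pow01_def)

lemma pow01_pos: "0 < x \<Longrightarrow> 0 < pow01 x w"
  by (simp add: pow01_def)

lemma borel_measurable_pow01 [measurable]:
  "f \<in> borel_measurable M \<Longrightarrow> (\<lambda>x. pow01 (f x) w) \<in> borel_measurable M"
  by (cases "w = 0") (simp_all add: pow01_def)

subsection \<open>Expectations of ratios of PDFs\<close>

lemma space_euclid: "space (euclid I) = I \<rightarrow>\<^sub>E UNIV"
  by (simp add: euclid_def space_PiM)

lemma sets_base_measure [measurable_cong]: "sets (base_measure k I) = sets (euclid I)"
  by (cases k) (auto simp: euclid_def intro!: sets_PiM_cong)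

lemma space_base_measure: "space (base_measure k I) = space (euclid I)"
  by (rule sets_eq_imp_space_eq[OF sets_base_measure])

lemma restrict_measurable_euclid:
  "J \<subseteq> I \<Longrightarrow> (\<lambda>x. restrict x J) \<in> euclid I \<rightarrow>\<^sub>M euclid J"
  unfolding euclid_def by (rule measurable_restrict_subset)

lemma nn_integral_base_Discrete:
  assumes "f \<in> borel_measurable (euclid I)"
  shows "(\<integral>\<^sup>+x. f x \<partial>base_measure Discrete I) = (\<integral>\<^sup>+x. f x \<partial>count_space (I \<rightarrow>\<^sub>E UNIV))"
  using assms by (simp add: space_euclid nn_integral_distr)

lemma AE_base_Discrete:
  assumes "Measurable.pred (euclid I) Q" "AE x in base_measure Discrete I. Q x" "x \<in> I \<rightarrow>\<^sub>E UNIV"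
  shows "Q x"
proof -
  have "AE x in count_space (I \<rightarrow>\<^sub>E UNIV). Q x"
    using assms(1,2) by (subst (asm) base_measure.simps, subst (asm) AE_distr_iff)
      (auto simp: space_euclid pred_def)
  then show ?thesis
    using assms(3) by (simp add: AE_count_space)
qed

lemma singleton_in_sets_euclid:
  assumes "finite I" "v \<in> I \<rightarrow>\<^sub>E UNIV"
  shows "{v} \<in> sets (euclid I)"
proof -
  have "{v} = (\<Pi>\<^sub>E i\<in>I. {v i})"
    using assms(2) PiE_singleton[of v I] by (simp add: PiE_def)
  then show ?thesis
    using assms(1) by (simp add: euclid_def sets_PiM_I_finite)
qed

lemma nn_integral_count_space_swap:
  "(\<integral>\<^sup>+p. f p \<partial>count_space (A \<times> B)) = (\<integral>\<^sup>+y. \<integral>\<^sup>+x. f (x, y) \<partial>count_space A \<partial>count_space B)"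
proof -
  have "(\<integral>\<^sup>+p. f p \<partial>count_space (A \<times> B)) = (\<integral>\<^sup>+p. f p * indicator (A \<times> B) p \<partial>count_space UNIV)"
    by (subst nn_integral_count_space_indicator) auto
  also have "\<dots> = (\<integral>\<^sup>+y. \<integral>\<^sup>+x. f (x, y) * indicator (A \<times> B) (x, y) \<partial>count_space UNIV \<partial>count_space UNIV)"
    by (rule nn_integral_snd_count_space[symmetric])
  also have "\<dots> = (\<integral>\<^sup>+y. (\<integral>\<^sup>+x. f (x, y) * indicator A x \<partial>count_space UNIV) * indicator B y \<partial>count_space UNIV)"
    by (intro nn_integral_cong) (auto simp: indicator_times split: split_indicator)
  also have "\<dots> = (\<integral>\<^sup>+y. \<integral>\<^sup>+x. f (x, y) \<partial>count_space A \<partial>count_space B)"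
    by (simp add: nn_integral_count_space_indicator)
  finally show ?thesis .
qed

lemma marginal_ratio_nn_integral_le:
  assumes f: "is_pdf k S f" and g: "is_marginal_pdf k \<mu> S g"
  shows "(\<integral>\<^sup>+x. ennreal (f (restrict x S) / g (restrict x S)) \<partial>\<mu>) \<le> 1"
proof -
  have dist: "distributed \<mu> (base_measure k S) (\<lambda>x. restrict x S) (\<lambda>x. ennreal (g x))"
    and [measurable]: "f \<in> borel_measurable (euclid S)" "g \<in> borel_measurable (euclid S)"
    using assms by (auto simp: is_marginal_pdf_def is_pdf_def)
  have "(\<integral>\<^sup>+x. ennreal (f (restrict x S) / g (restrict x S)) \<partial>\<mu>)
      = (\<integral>\<^sup>+y. ennreal (g y) * ennreal (f y / g y) \<partial>base_measure k S)"
    by (rule distributed_nn_integral[OF dist, symmetric]) measurable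
  also have "\<dots> \<le> (\<integral>\<^sup>+y. ennreal (f y) \<partial>base_measure k S)"
  proof (rule nn_integral_mono)
    fix y assume "y \<in> space (base_measure k S)"
    then have "0 \<le> f y" "0 \<le> g y"
      using f g by (auto simp: is_marginal_pdf_def is_pdf_def space_base_measure)
    then show "ennreal (g y) * ennreal (f y / g y) \<le> ennreal (f y)"
      by (cases "g y = 0") (auto simp flip: ennreal_mult')
  qed
  also have "\<dots> = 1"
    using f by (simp add: is_pdf_def)
  finally show ?thesis .
qed

lemma marginal_pdf_AE_pos:
  assumes "prob_space \<mu>" and g: "is_marginal_pdf k \<mu> S g"
  shows "AE x in \<mu>. 0 < g (restrict x S)"
proof -
  have dist: "distributed \<mu> (base_measure k S) (\<lambda>x. restrict x S) (\<lambda>x. ennreal (g x))"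
    and [measurable]: "g \<in> borel_measurable (euclid S)"
    using assms by (auto simp: is_marginal_pdf_def is_pdf_def)
  show ?thesis
    by (subst prob_space.distributed_AE2[OF \<open>prob_space \<mu>\<close> dist]) (auto simp: pred_def)
qed

text \<open>
  The conditional PDF integrates to 1 only for those \<open>v\<close> that are the \<open>B\<close>-subvector of a point of
  \<open>space \<mu>\<close>. The set of these need not be measurable, but it carries the whole \<open>B\<close>-marginal.
  Counting measure on an uncountable space is not \<open>\<sigma>\<close>-finite, which is why the two kinds of base
  measure are treated separately.
\<close>

lemma conditional_pdf_nn_integral:
  assumes fin: "finite A" "finite B" and disj: "A \<inter> B = {}"
    and \<mu>: "prob_space \<mu>" and h: "is_marginal_pdf k \<mu> B h"
    and g: "(\<lambda>x. g (restrict x A) (restrict x B)) \<in> borel_measurable (euclid (A \<union> B))"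
    and pdf: "\<And>x. x \<in> space \<mu> \<Longrightarrow> is_pdf k A (\<lambda>u. g u (restrict x B))"
  shows "(\<integral>\<^sup>+x. ennreal (g (restrict x A) (restrict x B)) * ennreal (h (restrict x B))
    \<partial>base_measure k (A \<union> B)) = 1"
proof -
  have dist: "distributed \<mu> (base_measure k B) (\<lambda>x. restrict x B) (\<lambda>x. ennreal (h x))"
    and h_meas [measurable]: "h \<in> borel_measurable (euclid B)"
    and h_int: "(\<integral>\<^sup>+v. ennreal (h v) \<partial>base_measure k B) = 1"
    using h by (auto simp: is_marginal_pdf_def is_pdf_def)
  have g' [measurable]:
      "(\<lambda>x. ennreal (g (restrict x A) (restrict x B))) \<in> borel_measurable (euclid (A \<union> B))"
    using g by measurable
  have h' [measurable]: "(\<lambda>x. ennreal (h (restrict x B))) \<in> borel_measurable (euclid (A \<union> B))"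
    using measurable_compose[OF restrict_measurable_euclid h_meas] by simp
  have [simp]: "restrict u I = u" if "u \<in> I \<rightarrow>\<^sub>E UNIV" for u :: vec and I
    using that by (simp add: PiE_restrict)
  show ?thesis
  proof (cases k)
    case Continuous
    interpret product_sigma_finite "\<lambda>_::nat. lborel :: real measure" by standard
    let ?L = "\<lambda>I. Pi\<^sub>M I (\<lambda>_::nat. lborel :: real measure)"
    define \<phi> where "\<phi> v = (\<integral>\<^sup>+u. ennreal (g u v) \<partial>?L A)" for v
    have sets_L [measurable_cong]: "sets (?L I) = sets (euclid I)" for I
      using sets_base_measure[of Continuous I] by simp
    have space_L: "space (?L I) = I \<rightarrow>\<^sub>E UNIV" for I
      by (simp add: space_PiM)
    interpret A: finite_product_sigma_finite "\<lambda>_::nat. lborel :: real measure" A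
      by standard (rule fin)
    have \<phi>_merge: "\<phi> v = (\<integral>\<^sup>+u. ennreal (g (restrict (merge B A (v, u)) A)
        (restrict (merge B A (v, u)) B)) \<partial>?L A)" if "v \<in> space (?L B)" for v
      unfolding \<phi>_def using that disj by (intro nn_integral_cong) (auto simp: space_L)
    have merge_meas: "merge B A \<in> ?L B \<Otimes>\<^sub>M ?L A \<rightarrow>\<^sub>M euclid (A \<union> B)"
      using measurable_merge[of B A "\<lambda>_. lborel :: real measure"]
      by (simp add: Un_commute[of B A] measurable_cong_sets[OF refl sets_L])
    have "(\<lambda>v. \<integral>\<^sup>+u. ennreal (g (restrict (merge B A (v, u)) A)
        (restrict (merge B A (v, u)) B)) \<partial>?L A) \<in> borel_measurable (?L B)"
      using measurable_compose[OF merge_meas g']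
      by (intro A.borel_measurable_nn_integral) (simp add: case_prod_beta')
    then have \<phi>_meas [measurable]: "\<phi> \<in> borel_measurable (?L B)"
      by (subst measurable_cong[OF \<phi>_merge])
    have "AE x in \<mu>. \<phi> (restrict x B) = 1"
      using pdf Continuous by (intro AE_I2) (auto simp: is_pdf_def \<phi>_def)
    then have \<phi>_1: "AE v in ?L B. 0 < ennreal (h v) \<longrightarrow> \<phi> v = 1"
      using prob_space.distributed_AE2[OF \<mu> dist[unfolded Continuous base_measure.simps], of "\<lambda>v. \<phi> v = 1"]
        measurable_equality_set[OF \<phi>_meas borel_measurable_const] by (simp add: pred_def)
    have "(\<integral>\<^sup>+x. ennreal (g (restrict x A) (restrict x B)) * ennreal (h (restrict x B))
        \<partial>?L (A \<union> B))
      = (\<integral>\<^sup>+v. \<integral>\<^sup>+u. ennreal (g (restrict (merge B A (v, u)) A) (restrict (merge B A (v, u)) B))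
          * ennreal (h (restrict (merge B A (v, u)) B)) \<partial>?L A \<partial>?L B)"
      using fin disj
      by (subst Un_commute, subst product_nn_integral_fold) (auto simp: Un_commute[of B A])
    also have "\<dots> = (\<integral>\<^sup>+v. \<phi> v * ennreal (h v) \<partial>?L B)"
    proof (rule nn_integral_cong)
      fix v assume v: "v \<in> space (?L B)"
      have "(\<lambda>u. ennreal (g (restrict (merge B A (v, u)) A) (restrict (merge B A (v, u)) B)))
          \<in> borel_measurable (?L A)"
        using v by (intro measurable_compose[OF _ g'] measurable_compose[OF _ merge_meas]) simp
      then have "(\<lambda>u. ennreal (g u v)) \<in> borel_measurable (?L A)"
        by (rule measurable_cong[THEN iffD1, rotated]) (use v disj in \<open>auto simp: space_L\<close>)
      then have "\<phi> v * ennreal (h v) = (\<integral>\<^sup>+u. ennreal (g u v) * ennreal (h v) \<partial>?L A)"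
        by (simp add: nn_integral_multc \<phi>_def)
      also have "\<dots> = (\<integral>\<^sup>+u. ennreal (g (restrict (merge B A (v, u)) A) (restrict (merge B A (v, u)) B))
          * ennreal (h (restrict (merge B A (v, u)) B)) \<partial>?L A)"
        using v disj by (intro nn_integral_cong) (auto simp: space_L)
      finally show "(\<integral>\<^sup>+u. ennreal (g (restrict (merge B A (v, u)) A) (restrict (merge B A (v, u)) B))
          * ennreal (h (restrict (merge B A (v, u)) B)) \<partial>?L A) = \<phi> v * ennreal (h v)" ..
    qed
    also have "\<dots> = (\<integral>\<^sup>+v. ennreal (h v) \<partial>?L B)"
      using \<phi>_1 by (intro nn_integral_cong_AE) (auto simp: zero_less_iff_neq_zero elim!: eventually_mono)
    finally show ?thesis
      using h_int Continuous by simp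
  next
    case Discrete
    let ?V = "\<lambda>I. I \<rightarrow>\<^sub>E (UNIV :: real set)"
    have inner: "(\<integral>\<^sup>+u. ennreal (g u v) \<partial>count_space (?V A)) * ennreal (h v) = ennreal (h v)"
      if v: "v \<in> ?V B" for v
    proof (cases "\<exists>x\<in>space \<mu>. restrict x B = v")
      case True
      then have "is_pdf k A (\<lambda>u. g u v)"
        using pdf by auto
      then have "(\<integral>\<^sup>+u. ennreal (g u v) \<partial>count_space (?V A)) = 1"
        using nn_integral_base_Discrete[of "\<lambda>u. ennreal (g u v)" A] Discrete
        by (simp add: is_pdf_def del: base_measure.simps)
      then show ?thesis
        by simp
    next
      case False
      have [measurable]: "Measurable.pred (euclid B) (\<lambda>y. y \<noteq> v)"
        using singleton_in_sets_euclid[OF fin(2) v]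
        by (intro pred_intros_logic) (simp add: pred_def space_euclid v Collect_conv_if cong: conj_cong)
      have "AE x in \<mu>. restrict x B \<noteq> v"
        using False by (intro AE_I2) auto
      then have "AE y in base_measure Discrete B. 0 < ennreal (h y) \<longrightarrow> y \<noteq> v"
        by (subst (asm) prob_space.distributed_AE2[OF \<mu> dist[unfolded Discrete]])
          (simp_all del: base_measure.simps add: measurable_cong_sets[OF sets_base_measure refl])
      from AE_base_Discrete[OF _ this v] have "\<not> 0 < ennreal (h v)"
        by simp
      then show ?thesis
        by (simp add: zero_less_iff_neq_zero)
    qed
    have bij: "bij_betw (merge A B) (?V A \<times> ?V B) (?V (A \<union> B))"
      by (rule bij_betw_byWitness[where f' = "\<lambda>x. (restrict x A, restrict x B)"])
        (use disj in auto)
    have "(\<integral>\<^sup>+x. ennreal (g (restrict x A) (restrict x B)) * ennreal (h (restrict x B))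
        \<partial>base_measure k (A \<union> B))
      = (\<integral>\<^sup>+x. ennreal (g (restrict x A) (restrict x B)) * ennreal (h (restrict x B))
        \<partial>count_space (?V (A \<union> B)))"
      unfolding Discrete by (rule nn_integral_base_Discrete) measurable
    also have "\<dots> = (\<integral>\<^sup>+p. ennreal (g (restrict (merge A B p) A) (restrict (merge A B p) B))
        * ennreal (h (restrict (merge A B p) B)) \<partial>count_space (?V A \<times> ?V B))"
      by (rule nn_integral_bij_count_space[OF bij, symmetric])
    also have "\<dots> = (\<integral>\<^sup>+v. \<integral>\<^sup>+u. ennreal (g u v) * ennreal (h v)
        \<partial>count_space (?V A) \<partial>count_space (?V B))"
      unfolding nn_integral_count_space_swap
      using disj by (intro nn_integral_cong) simp
    also have "\<dots> = (\<integral>\<^sup>+v. ennreal (h v) \<partial>count_space (?V B))"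
      by (intro nn_integral_cong) (simp add: nn_integral_multc inner)
    also have "\<dots> = 1"
      using h_int nn_integral_base_Discrete[of "\<lambda>v. ennreal (h v)" B] Discrete
      by (simp del: base_measure.simps)
    finally show ?thesis .
  qed
qed

lemma conditional_pdf_AE_eq:
  assumes \<mu>: "prob_space \<mu>"
    and f: "is_marginal_pdf k \<mu> (A \<union> B) f" and h: "is_marginal_pdf k \<mu> B h"
    and g: "is_conditional_pdf k \<X> A B f h g"
  shows "AE x in \<mu>. 0 < f (restrict x (A \<union> B)) \<and> 0 < h (restrict x B) \<and>
    g (restrict x A) (restrict x B) = f (restrict x (A \<union> B)) / h (restrict x B)"
proof -
  have dist: "distributed \<mu> (base_measure k (A \<union> B)) (\<lambda>x. restrict x (A \<union> B)) (\<lambda>x. ennreal (f x))"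
    and [measurable]: "f \<in> borel_measurable (euclid (A \<union> B))"
    and h_meas: "h \<in> borel_measurable (euclid B)"
    and [measurable]: "(\<lambda>x. g (restrict x A) (restrict x B)) \<in> borel_measurable (euclid (A \<union> B))"
    using assms by (auto simp: is_marginal_pdf_def is_pdf_def is_conditional_pdf_def)
  have [measurable]: "(\<lambda>x. h (restrict x B)) \<in> borel_measurable (euclid (A \<union> B))"
    using measurable_compose[OF restrict_measurable_euclid h_meas] by simp
  have [simp]: "(A \<union> B) \<inter> A = A" "(A \<union> B) \<inter> B = B"
    by auto
  have "AE x in base_measure k (A \<union> B). 0 < ennreal (f x) \<longrightarrow> (0 < h (restrict x B) \<longrightarrow>
      g (restrict x A) (restrict x B) = f x / h (restrict x B))"
    using g by (auto simp: is_conditional_pdf_def)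
  moreover have [measurable]: "Measurable.pred (euclid (A \<union> B)) (\<lambda>x.
      g (restrict x A) (restrict x B) = f x / h (restrict x B))"
    unfolding pred_def by (rule measurable_equality_set) measurable
  moreover have "Measurable.pred (euclid (A \<union> B)) (\<lambda>x. 0 < h (restrict x B) \<longrightarrow>
      g (restrict x A) (restrict x B) = f x / h (restrict x B))"
    by measurable
  ultimately have "AE x in \<mu>. 0 < h (restrict x B) \<longrightarrow>
      g (restrict x A) (restrict x B) = f (restrict x (A \<union> B)) / h (restrict x B)"
    by (subst (asm) prob_space.distributed_AE2[OF \<mu> dist, symmetric])
      (simp_all add: measurable_cong_sets[OF sets_base_measure refl])
  with marginal_pdf_AE_pos[OF \<mu> f] marginal_pdf_AE_pos[OF \<mu> h] show ?thesis
    by eventually_elim auto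
qed

lemma conditional_ratio_nn_integral_le:
  assumes fin: "finite A" "finite B" and disj: "A \<inter> B = {}"
    and \<mu>: "prob_space \<mu>"
    and f: "is_marginal_pdf k \<mu> (A \<union> B) f" and h: "is_marginal_pdf k \<mu> B h"
    and g: "is_conditional_pdf k (space \<mu>) A B f h g"
    and g': "is_conditional_pdf k (space \<mu>) A B f' h' g'"
  shows "(\<integral>\<^sup>+x. ennreal (g' (restrict x A) (restrict x B) / g (restrict x A) (restrict x B)) \<partial>\<mu>) \<le> 1"
proof -
  have dist: "distributed \<mu> (base_measure k (A \<union> B)) (\<lambda>x. restrict x (A \<union> B)) (\<lambda>x. ennreal (f x))"
    and [measurable]: "f \<in> borel_measurable (euclid (A \<union> B))"
    and h_meas: "h \<in> borel_measurable (euclid B)"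
    and g'_meas [measurable]:
      "(\<lambda>x. g' (restrict x A) (restrict x B)) \<in> borel_measurable (euclid (A \<union> B))"
    using f h g' by (auto simp: is_marginal_pdf_def is_pdf_def is_conditional_pdf_def)
  have [measurable]: "(\<lambda>x. h (restrict x B)) \<in> borel_measurable (euclid (A \<union> B))"
    using measurable_compose[OF restrict_measurable_euclid h_meas] by simp
  have [simp]: "(A \<union> B) \<inter> A = A" "(A \<union> B) \<inter> B = B"
    by auto
  have f_nn: "0 \<le> f x" and h_nn: "0 \<le> h (restrict x B)" if "x \<in> space (euclid (A \<union> B))" for x
    using that f h measurable_space[OF restrict_measurable_euclid[of B "A \<union> B"]]
    by (auto simp: is_marginal_pdf_def is_pdf_def)
  let ?c = "\<lambda>x. g' (restrict x A) (restrict x B)"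
  have "(\<integral>\<^sup>+x. ennreal (?c x / g (restrict x A) (restrict x B)) \<partial>\<mu>)
      = (\<integral>\<^sup>+x. ennreal (?c (restrict x (A \<union> B)) * h (restrict (restrict x (A \<union> B)) B)
          / f (restrict x (A \<union> B))) \<partial>\<mu>)"
    using conditional_pdf_AE_eq[OF \<mu> f h g]
    by (intro nn_integral_cong_AE, eventually_elim) simp
  also have "\<dots> = (\<integral>\<^sup>+y. ennreal (f y) * ennreal (?c y * h (restrict y B) / f y)
      \<partial>base_measure k (A \<union> B))"
    by (rule distributed_nn_integral[OF dist, symmetric]) measurable
  also have "\<dots> \<le> (\<integral>\<^sup>+y. ennreal (?c y) * ennreal (h (restrict y B)) \<partial>base_measure k (A \<union> B))"
  proof (rule nn_integral_mono)
    fix y assume y: "y \<in> space (base_measure k (A \<union> B))"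
    then show "ennreal (f y) * ennreal (?c y * h (restrict y B) / f y)
        \<le> ennreal (?c y) * ennreal (h (restrict y B))"
      using f_nn[of y] h_nn[of y]
      by (cases "f y = 0") (auto simp: space_base_measure simp flip: ennreal_mult' ennreal_mult'')
  qed
  also have "\<dots> = 1"
    using g' unfolding is_conditional_pdf_def
    by (intro conditional_pdf_nn_integral[OF fin disj \<mu> h g'_meas]) blast
  finally show ?thesis .
qed

subsection \<open>Ville's inequality without joint measurability\<close>

lemma restrict_fun_upd_Suc:
  assumes "x \<in> extensional {1..j::nat}"
  shows "restrict (x(Suc j := y)) {1..j} = x"
    and "i \<le> j \<Longrightarrow> restrict (x(Suc j := y)) {1..i} = restrict x {1..i}"
  using assms by (auto simp: fun_eq_iff extensional_def)

text \<open>
  \<open>r i x y\<close> is the factor contributed by observation \<open>i + 1\<close> with value \<open>y\<close> after the past \<open>x\<close>, and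
  \<open>E n\<close> is the event that the threshold \<open>1 / C\<close> is crossed at time \<open>n\<close>.
\<close>

lemma ville_finite_horizon:
  fixes \<mu> :: "'a measure" and r :: "nat \<Rightarrow> (nat \<Rightarrow> 'a) \<Rightarrow> 'a \<Rightarrow> ennreal"
    and E :: "nat \<Rightarrow> (nat \<Rightarrow> 'a) set" and C :: ennreal
  assumes \<mu>: "prob_space \<mu>" and G: "AE y in \<mu>. y \<in> G" "G \<subseteq> space \<mu>"
    and E: "\<And>n. 1 \<le> n \<Longrightarrow> E n \<in> sets (PiM {1..n} (\<lambda>_. \<mu>))"
    and r_meas: "\<And>i x. x \<in> {1..i} \<rightarrow>\<^sub>E G \<Longrightarrow> r i x \<in> borel_measurable \<mu>"
    and r_int: "\<And>i x. x \<in> {1..i} \<rightarrow>\<^sub>E G \<Longrightarrow> (\<integral>\<^sup>+y. r i x y \<partial>\<mu>) \<le> 1"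
    and crossing: "\<And>n x. 1 \<le> n \<Longrightarrow> x \<in> {1..n} \<rightarrow>\<^sub>E G \<Longrightarrow> x \<in> E n \<Longrightarrow>
      1 \<le> C * (\<Prod>i=1..n. r (i - 1) (restrict x {1..i - 1}) (x i))"
  shows "emeasure (PiM {1..N} (\<lambda>_. \<mu>))
    {x \<in> space (PiM {1..N} (\<lambda>_. \<mu>)). \<exists>n\<in>{1..N}. restrict x {1..n} \<in> E n} \<le> C"
proof -
  interpret \<mu>: prob_space \<mu> by fact
  interpret product_prob_space "\<lambda>_::nat. \<mu>" by standard
  let ?P = "\<lambda>I. PiM I (\<lambda>_::nat. \<mu>)"
  define S where "S = {x \<in> space (?P {1..N}). \<exists>n\<in>{1..N}. restrict x {1..n} \<in> E n}"
  define R where "R n x = (\<Prod>i=1..n. r (i - 1) (restrict x {1..i - 1}) (x i))" for n x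
  have S [measurable]: "S \<in> sets (?P {1..N})"
  proof -
    have "Measurable.pred (?P {1..N}) (\<lambda>x. restrict x {1..n} \<in> E n)" if "n \<in> {1..N}" for n
      using that by (intro pred_sets2[OF E] measurable_restrict_subset) auto
    then show ?thesis
      unfolding S_def by (intro predE pred_intros_finite) auto
  qed
  \<comment> \<open>Given a past \<open>x\<close> without crossing, the probability of crossing by time \<open>N\<close> is at most \<open>C * R j x\<close>.\<close>
  have main: "(\<integral>\<^sup>+z. indicator S (merge {1..j} {Suc j..N} (x, z)) \<partial>?P {Suc j..N}) \<le> C * R j x"
    if "j \<le> N" "x \<in> {1..j} \<rightarrow>\<^sub>E G" "\<forall>n\<in>{1..j}. restrict x {1..n} \<notin> E n" for j x
    using that
  proof (induction j arbitrary: x rule: inc_induct)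
    case base
    have "merge {1..N} {Suc N..N} (x, z) = x" for z
      using base.prems(1) by (auto simp: merge_def fun_eq_iff PiE_iff extensional_def)
    moreover have "x \<notin> S"
      using base.prems(2) unfolding S_def by blast
    ultimately show ?case
      by simp
  next
    case (step j)
    have x_space: "x \<in> space (?P {1..j})" and x_ext: "x \<in> extensional {1..j}"
      using step.prems(1) G(2) by (auto simp: space_PiM PiE_iff)
    have split: "{Suc j..N} = insert (Suc j) {Suc (Suc j)..N}"
      using step.hyps by auto
    have insert_rev: "(\<integral>\<^sup>+z. f z \<partial>?P {Suc j..N})
        = (\<integral>\<^sup>+y. \<integral>\<^sup>+z. f (z(Suc j := y)) \<partial>?P {Suc (Suc j)..N} \<partial>\<mu>)"
      if "f \<in> borel_measurable (?P {Suc j..N})" for f :: "(nat \<Rightarrow> 'a) \<Rightarrow> ennreal"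
      using that unfolding split by (intro product_nn_integral_insert_rev) auto
    have un: "{1..j} \<union> {Suc j..N} = {1..N}"
      using step.hyps by auto
    have "merge {1..j} {Suc j..N} \<in> ?P {1..j} \<Otimes>\<^sub>M ?P {Suc j..N} \<rightarrow>\<^sub>M ?P {1..N}"
      using measurable_merge[of "{1..j}" "{Suc j..N}" "\<lambda>_. \<mu>"] unfolding un .
    note merge_meas = this
    have meas: "(\<lambda>z. indicator S (merge {1..j} {Suc j..N} (x, z)) :: ennreal)
        \<in> borel_measurable (?P {Suc j..N})"
      using x_space by (intro measurable_compose[OF _ borel_measurable_indicator[OF S]]
        measurable_compose[OF _ merge_meas]) simp
    have merge_upd: "merge {1..j} {Suc j..N} (x, z(Suc j := y))
        = merge {1..Suc j} {Suc (Suc j)..N} (x(Suc j := y), z)" for y z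
      using step.hyps by (auto simp: merge_def fun_eq_iff)
    have "(\<integral>\<^sup>+z. indicator S (merge {1..j} {Suc j..N} (x, z)) \<partial>?P {Suc j..N})
        = (\<integral>\<^sup>+y. \<integral>\<^sup>+z. indicator S (merge {1..Suc j} {Suc (Suc j)..N} (x(Suc j := y), z))
            \<partial>?P {Suc (Suc j)..N} \<partial>\<mu>)"
      using insert_rev[OF meas] unfolding merge_upd .
    also have "\<dots> \<le> (\<integral>\<^sup>+y. C * R j x * r j x y \<partial>\<mu>)"
    proof (rule nn_integral_mono_AE, use G(1) in eventually_elim)
      fix y assume "y \<in> G"
      let ?x = "x(Suc j := y)"
      let ?I = "\<integral>\<^sup>+z. indicator S (merge {1..Suc j} {Suc (Suc j)..N} (?x, z)) \<partial>?P {Suc (Suc j)..N}"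
      have x': "?x \<in> {1..Suc j} \<rightarrow>\<^sub>E G"
        using step.prems(1) \<open>y \<in> G\<close> by (auto simp: PiE_iff extensional_def)
      have "(\<Prod>i=1..j. r (i - 1) (restrict ?x {1..i - 1}) (?x i)) = R j x"
        unfolding R_def by (intro prod.cong refl) (auto simp: restrict_fun_upd_Suc(2)[OF x_ext])
      then have R_Suc: "R (Suc j) ?x = R j x * r j x y"
        unfolding R_def using PiE_restrict[OF step.prems(1)]
        by (simp add: restrict_fun_upd_Suc(1)[OF x_ext])
      have "?I \<le> C * R (Suc j) ?x"
      proof (cases "?x \<in> E (Suc j)")
        case True
        have "?I \<le> (\<integral>\<^sup>+z. 1 \<partial>?P {Suc (Suc j)..N})"
          by (intro nn_integral_mono) (simp add: indicator_def)
        also have "\<dots> = 1"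
          by (simp add: prob_space.emeasure_space_1[OF prob_space_PiM] \<mu>)
        also have "\<dots> \<le> C * R (Suc j) ?x"
          unfolding R_def using x' True by (intro crossing) auto
        finally show ?thesis .
      next
        case False
        have "restrict ?x {1..Suc j} = ?x"
          using x' by (rule PiE_restrict)
        have "\<forall>n\<in>{1..Suc j}. restrict ?x {1..n} \<notin> E n"
        proof
          fix n assume "n \<in> {1..Suc j}"
          then consider "n = Suc j" | "n \<le> j" "n \<in> {1..j}"
            by (auto simp: le_Suc_eq)
          then show "restrict ?x {1..n} \<notin> E n"
          proof cases
            case 1
            then show ?thesis
              using \<open>restrict ?x {1..Suc j} = ?x\<close> False by metis
          next
            case 2
            then show ?thesis
              using restrict_fun_upd_Suc(2)[OF x_ext, of n y] step.prems(2) by metis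
          qed
        qed
        then show ?thesis
          by (intro step.IH x')
      qed
      then show "?I \<le> C * R j x * r j x y"
        by (simp add: R_Suc mult.assoc)
    qed
    also have "\<dots> = C * R j x * (\<integral>\<^sup>+y. r j x y \<partial>\<mu>)"
      by (intro nn_integral_cmult r_meas step.prems)
    also have "\<dots> \<le> C * R j x * 1"
      by (intro mult_left_mono r_int step.prems) auto
    finally show ?case
      by simp
  qed
  have "emeasure (?P {1..N}) S = (\<integral>\<^sup>+z. indicator S z \<partial>?P {1..N})"
    by (rule nn_integral_indicator[OF S, symmetric])
  also have "\<dots> = (\<integral>\<^sup>+z. indicator S (merge {1..0} {Suc 0..N} (\<lambda>_. undefined, z)) \<partial>?P {Suc 0..N})"
  proof -
    have "merge {1..0} {Suc 0..N} (\<lambda>_. undefined, z) = z" if "z \<in> space (?P {1..N})" for z :: "nat \<Rightarrow> 'a"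
      using that by (auto simp: merge_def fun_eq_iff space_PiM PiE_iff extensional_def)
    then show ?thesis
      unfolding One_nat_def by (intro nn_integral_cong) simp
  qed
  also have "\<dots> \<le> C * R 0 (\<lambda>_. undefined)"
    by (rule main) auto
  finally show ?thesis
    by (simp add: R_def S_def)
qed

lemma iid_sample_law:
  assumes iid: "iid_sample M S X \<mu>" and N: "1 \<le> N"
  shows "(\<lambda>\<omega>. \<lambda>i\<in>{1..N}. X i \<omega>) \<in> M \<rightarrow>\<^sub>M PiM {1..N} (\<lambda>_. S)"
    and "distr M (PiM {1..N} (\<lambda>_. S)) (\<lambda>\<omega>. \<lambda>i\<in>{1..N}. X i \<omega>) = PiM {1..N} (\<lambda>_. \<mu>)"
proof -
  interpret M: prob_space M
    using iid by (simp add: iid_sample_def)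
  have indep: "M.indep_vars (\<lambda>_. S) X {1..N}"
    using iid by (auto simp: iid_sample_def intro: M.indep_vars_subset)
  then have X: "\<And>i. i \<in> {1..N} \<Longrightarrow> X i \<in> M \<rightarrow>\<^sub>M S"
    by (simp add: M.indep_vars_def)
  then show "(\<lambda>\<omega>. \<lambda>i\<in>{1..N}. X i \<omega>) \<in> M \<rightarrow>\<^sub>M PiM {1..N} (\<lambda>_. S)"
    by (rule measurable_restrict)
  have "distr M (PiM {1..N} (\<lambda>_. S)) (\<lambda>\<omega>. \<lambda>i\<in>{1..N}. X i \<omega>)
      = PiM {1..N} (\<lambda>i. distr M S (X i))"
    using indep X N by (subst M.indep_vars_iff_distr_eq_PiM'[symmetric]) auto
  also have "\<dots> = PiM {1..N} (\<lambda>_. \<mu>)"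
    using iid by (intro PiM_cong) (auto simp: iid_sample_def)
  finally show "distr M (PiM {1..N} (\<lambda>_. S)) (\<lambda>\<omega>. \<lambda>i\<in>{1..N}. X i \<omega>) = PiM {1..N} (\<lambda>_. \<mu>)" .
qed

lemma ville_iid_sample:
  fixes \<mu> :: "'a measure" and r :: "nat \<Rightarrow> (nat \<Rightarrow> 'a) \<Rightarrow> 'a \<Rightarrow> ennreal"
    and E :: "nat \<Rightarrow> (nat \<Rightarrow> 'a) set" and C :: ennreal
  assumes iid: "iid_sample M S X \<mu>" and G: "AE y in \<mu>. y \<in> G" "G \<subseteq> space \<mu>"
    and E: "\<And>n. 1 \<le> n \<Longrightarrow> E n \<in> sets (PiM {1..n} (\<lambda>_. \<mu>))"
    and r_meas: "\<And>i x. x \<in> {1..i} \<rightarrow>\<^sub>E G \<Longrightarrow> r i x \<in> borel_measurable \<mu>"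
    and r_int: "\<And>i x. x \<in> {1..i} \<rightarrow>\<^sub>E G \<Longrightarrow> (\<integral>\<^sup>+y. r i x y \<partial>\<mu>) \<le> 1"
    and crossing: "\<And>n x. 1 \<le> n \<Longrightarrow> x \<in> {1..n} \<rightarrow>\<^sub>E G \<Longrightarrow> x \<in> E n \<Longrightarrow>
      1 \<le> C * (\<Prod>i=1..n. r (i - 1) (restrict x {1..i - 1}) (x i))"
  shows "emeasure M {\<omega> \<in> space M. \<exists>n\<ge>1. restrict (\<lambda>i. X i \<omega>) {1..n} \<in> E n} \<le> C"
proof -
  interpret M: prob_space M
    using iid by (simp add: iid_sample_def)
  have X1: "X 1 \<in> M \<rightarrow>\<^sub>M S" and \<mu>_eq: "\<mu> = distr M S (X 1)"
    using iid by (auto simp: iid_sample_def M.indep_vars_def)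
  have \<mu>: "prob_space \<mu>"
    unfolding \<mu>_eq by (rule M.prob_space_distr[OF X1])
  have sets_\<mu>: "sets (PiM I (\<lambda>_. S)) = sets (PiM I (\<lambda>_. \<mu>))" for I :: "nat set"
    unfolding \<mu>_eq by (intro sets_PiM_cong) simp_all
  define A where "A N = {\<omega> \<in> space M. \<exists>n\<in>{1..Suc N}. restrict (\<lambda>i. X i \<omega>) {1..n} \<in> E n}" for N
  define B where "B N = {x \<in> space (PiM {1..Suc N} (\<lambda>_. \<mu>)). \<exists>n\<in>{1..Suc N}. restrict x {1..n} \<in> E n}" for N
  have restr: "restrict (restrict f {1..N}) {1..n} = restrict f {1..n}" if "n \<le> N"
    for f :: "nat \<Rightarrow> 'a" and n N :: nat
    using that by (auto simp: fun_eq_iff)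
  have B_sets: "B N \<in> sets (PiM {1..Suc N} (\<lambda>_. \<mu>))" for N
  proof -
    have "Measurable.pred (PiM {1..Suc N} (\<lambda>_. \<mu>)) (\<lambda>x. restrict x {1..n} \<in> E n)"
      if "n \<in> {1..Suc N}" for n
      using that by (intro pred_sets2[OF E] measurable_restrict_subset) auto
    then show ?thesis
      unfolding B_def by (intro predE pred_intros_finite) auto
  qed
  have law: "(\<lambda>\<omega>. \<lambda>i\<in>{1..Suc N}. X i \<omega>) \<in> M \<rightarrow>\<^sub>M PiM {1..Suc N} (\<lambda>_. S)" for N
    by (rule iid_sample_law[OF iid]) simp
  have A_eq: "A N = (\<lambda>\<omega>. \<lambda>i\<in>{1..Suc N}. X i \<omega>) -` B N \<inter> space M" for N
  proof (intro set_eqI)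
    fix \<omega>
    have "(\<lambda>i\<in>{1..Suc N}. X i \<omega>) \<in> space (PiM {1..Suc N} (\<lambda>_. \<mu>))" if "\<omega> \<in> space M"
      using measurable_space[OF law that] sets_eq_imp_space_eq[OF sets_\<mu>] by blast
    moreover have "(\<exists>n\<in>{1..Suc N}. restrict (\<lambda>i\<in>{1..Suc N}. X i \<omega>) {1..n} \<in> E n)
        \<longleftrightarrow> (\<exists>n\<in>{1..Suc N}. restrict (\<lambda>i. X i \<omega>) {1..n} \<in> E n)"
    proof (intro bex_cong refl)
      fix n assume "n \<in> {1..Suc N}"
      then have "restrict (\<lambda>i\<in>{1..Suc N}. X i \<omega>) {1..n} = restrict (\<lambda>i. X i \<omega>) {1..n}"
        by (intro restr) simp
      then show "restrict (\<lambda>i\<in>{1..Suc N}. X i \<omega>) {1..n} \<in> E n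
          \<longleftrightarrow> restrict (\<lambda>i. X i \<omega>) {1..n} \<in> E n"
        by (simp only:)
    qed
    ultimately show "\<omega> \<in> A N \<longleftrightarrow> \<omega> \<in> (\<lambda>\<omega>. \<lambda>i\<in>{1..Suc N}. X i \<omega>) -` B N \<inter> space M"
      unfolding A_def B_def Int_iff vimage_eq mem_Collect_eq by blast
  qed
  have A_sets: "A N \<in> sets M" for N
    unfolding A_eq using B_sets by (intro measurable_sets[OF law]) (simp add: sets_\<mu>)
  have A_le: "emeasure M (A N) \<le> C" for N
  proof -
    have "emeasure M (A N) = emeasure (distr M (PiM {1..Suc N} (\<lambda>_. S)) (\<lambda>\<omega>. \<lambda>i\<in>{1..Suc N}. X i \<omega>)) (B N)"
      unfolding A_eq using B_sets law by (subst emeasure_distr) (simp_all add: sets_\<mu>)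
    also have "\<dots> = emeasure (PiM {1..Suc N} (\<lambda>_. \<mu>)) (B N)"
      by (subst iid_sample_law(2)[OF iid]) simp_all
    also have "\<dots> \<le> C"
      unfolding B_def by (rule ville_finite_horizon[OF \<mu> G E r_meas r_int crossing])
    finally show ?thesis .
  qed
  have "{\<omega> \<in> space M. \<exists>n\<ge>1. restrict (\<lambda>i. X i \<omega>) {1..n} \<in> E n} = (\<Union>N. A N)"
  proof (intro set_eqI iffI)
    fix \<omega> assume "\<omega> \<in> {\<omega> \<in> space M. \<exists>n\<ge>1. restrict (\<lambda>i. X i \<omega>) {1..n} \<in> E n}"
    then obtain n where "\<omega> \<in> space M" "1 \<le> n" "restrict (\<lambda>i. X i \<omega>) {1..n} \<in> E n"
      by blast
    moreover from this have "n \<in> {1..Suc n}"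
      by simp
    ultimately have "\<omega> \<in> A n"
      unfolding A_def by blast
    then show "\<omega> \<in> (\<Union>N. A N)"
      by blast
  next
    fix \<omega> assume "\<omega> \<in> (\<Union>N. A N)"
    then obtain N where "\<omega> \<in> A N"
      by (rule UN_E)
    then obtain n where "\<omega> \<in> space M" and n: "n \<in> {1..Suc N}" "restrict (\<lambda>i. X i \<omega>) {1..n} \<in> E n"
      unfolding A_def by (elim CollectE conjE bexE)
    moreover from n have "1 \<le> n"
      by simp
    ultimately show "\<omega> \<in> {\<omega> \<in> space M. \<exists>n\<ge>1. restrict (\<lambda>i. X i \<omega>) {1..n} \<in> E n}"
      by (intro CollectI conjI exI[of _ n])
  qed
  moreover have "incseq A"
  proof (intro incseq_SucI)
    fix N
    have "{1..Suc N} \<subseteq> {1..Suc (Suc N)}"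
      by auto
    then show "A N \<subseteq> A (Suc N)"
      unfolding A_def by blast
  qed
  then have "emeasure M (\<Union>N. A N) = (SUP N. emeasure M (A N))"
    using A_sets by (intro SUP_emeasure_incseq[symmetric]) auto
  ultimately show ?thesis
    using A_le by (simp add: SUP_least)
qed

subsection \<open>The composite likelihood ratio\<close>

lemma finite_marginal_indices: "finite (marginal_indices d)"
  by (rule finite_subset[of _ "Pow {1..d}"]) (auto simp: marginal_indices_def)

lemma finite_conditional_indices: "finite (conditional_indices d)"
  by (rule finite_subset[of _ "Pow {1..d} \<times> Pow {1..d}"]) (auto simp: conditional_indices_def)

lemma conditional_indices_marginal:
  assumes "(A, B) \<in> conditional_indices d"
  shows "finite A" "finite B" "A \<inter> B = {}" "A \<union> B \<subseteq> {1..d}"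
    "B \<in> marginal_indices d" "A \<union> B \<in> marginal_indices d"
  using assms finite_subset[of A "{1..d}"] finite_subset[of B "{1..d}"]
  by (auto simp: conditional_indices_def marginal_indices_def)

lemma composite_likelihood_nonneg: "0 \<le> composite_likelihood d \<alpha> \<beta> m c \<theta> x"
  by (auto simp: composite_likelihood_def pow01_nonneg intro!: mult_nonneg_nonneg prod_nonneg)

context
  fixes k :: dist_kind and d :: nat and \<X> \<Theta> :: "vec set" and P :: "vec \<Rightarrow> vec measure"
    and m :: "nat set \<Rightarrow> vec \<Rightarrow> vec \<Rightarrow> real"
    and c :: "nat set \<times> nat set \<Rightarrow> vec \<Rightarrow> vec \<Rightarrow> vec \<Rightarrow> real"
  assumes \<X>: "\<X> \<subseteq> space (euclid {1..d})"
    and family: "parametric_family k d \<X> \<Theta> P m c"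
begin

lemma family_prob_space: "\<theta> \<in> \<Theta> \<Longrightarrow> prob_space (P \<theta>)"
  using family by (auto simp: parametric_family_def)

lemma family_sets: "\<theta> \<in> \<Theta> \<Longrightarrow> sets (P \<theta>) = sets (sample_space d \<X>)"
  using family by (auto simp: parametric_family_def)

lemma family_space: "\<theta> \<in> \<Theta> \<Longrightarrow> space (P \<theta>) = \<X>"
  using sets_eq_imp_space_eq[OF family_sets] \<X>
  by (auto simp: sample_space_def space_restrict_space)

lemma family_marginal:
  "\<theta> \<in> \<Theta> \<Longrightarrow> S \<in> marginal_indices d \<Longrightarrow> is_marginal_pdf k (P \<theta>) S (m S \<theta>)"
  using family by (auto simp: parametric_family_def)

lemma family_conditional:
  assumes "\<theta> \<in> \<Theta>" "(A, B) \<in> conditional_indices d"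
  shows "is_conditional_pdf k \<X> A B (m (A \<union> B) \<theta>) (m B \<theta>) (c (A, B) \<theta>)"
  using family assms unfolding parametric_family_def by blast

lemma marginal_nonneg:
  assumes "\<theta> \<in> \<Theta>" "S \<in> marginal_indices d" "x \<in> \<X>"
  shows "0 \<le> m S \<theta> (restrict x S)"
  using family_marginal[OF assms(1,2)] by (auto simp: is_marginal_pdf_def is_pdf_def space_euclid)

lemma conditional_nonneg:
  assumes "\<theta> \<in> \<Theta>" "(A, B) \<in> conditional_indices d" "x \<in> \<X>"
  shows "0 \<le> c (A, B) \<theta> (restrict x A) (restrict x B)"
  using family_conditional[OF assms(1,2)] assms(3)
  by (auto simp: is_conditional_pdf_def is_pdf_def space_euclid)

lemma measurable_on_family:
  assumes "\<theta> \<in> \<Theta>" "S \<subseteq> {1..d}" "f \<in> borel_measurable (euclid S)"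
  shows "(\<lambda>x. f (restrict x S)) \<in> borel_measurable (P \<theta>)"
proof -
  have "(\<lambda>x. f (restrict x S)) \<in> borel_measurable (sample_space d \<X>)"
    unfolding sample_space_def
    by (intro measurable_restrict_space1 measurable_compose[OF restrict_measurable_euclid assms(3)] assms(2))
  then show ?thesis
    by (simp add: measurable_cong_sets[OF family_sets[OF assms(1)] refl])
qed

lemma marginal_measurable:
  assumes "\<theta> \<in> \<Theta>" "\<theta>' \<in> \<Theta>" "S \<in> marginal_indices d"
  shows "(\<lambda>x. m S \<theta> (restrict x S)) \<in> borel_measurable (P \<theta>')"
  using assms family_marginal[OF assms(1,3)]
  by (intro measurable_on_family) (auto simp: marginal_indices_def is_marginal_pdf_def is_pdf_def)

lemma conditional_measurable:
  assumes "\<theta> \<in> \<Theta>" "\<theta>' \<in> \<Theta>" and AB: "(A, B) \<in> conditional_indices d"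
  shows "(\<lambda>x. c (A, B) \<theta> (restrict x A) (restrict x B)) \<in> borel_measurable (P \<theta>')"
proof -
  have eq: "(A \<union> B) \<inter> A = A" "(A \<union> B) \<inter> B = B"
    by auto
  have "(\<lambda>x. c (A, B) \<theta> (restrict x A) (restrict x B)) \<in> borel_measurable (euclid (A \<union> B))"
    using family_conditional[OF assms(1) AB] unfolding is_conditional_pdf_def by (elim conjE)
  from measurable_on_family[OF assms(2) conditional_indices_marginal(4)[OF AB] this]
  show ?thesis
    by (simp only: restrict_restrict eq)
qed

lemma composite_likelihood_measurable:
  assumes "\<theta> \<in> \<Theta>" "\<theta>' \<in> \<Theta>"
  shows "composite_likelihood d \<alpha> \<beta> m c \<theta> \<in> borel_measurable (P \<theta>')"
  unfolding composite_likelihood_def[abs_def] split_beta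
proof (intro borel_measurable_times borel_measurable_prod borel_measurable_pow01)
  fix S assume "S \<in> marginal_indices d"
  then show "(\<lambda>x. m S \<theta> (restrict x S)) \<in> borel_measurable (P \<theta>')"
    by (rule marginal_measurable[OF assms])
next
  fix T assume "T \<in> conditional_indices d"
  then show "(\<lambda>x. c (fst T, snd T) \<theta> (restrict x (fst T)) (restrict x (snd T))) \<in> borel_measurable (P \<theta>')"
    by (intro conditional_measurable[OF assms]) simp
qed

lemma composite_likelihood_AE_pos:
  assumes \<theta>: "\<theta> \<in> \<Theta>"
  shows "AE x in P \<theta>. 0 < composite_likelihood d \<alpha> \<beta> m c \<theta> x"
proof -
  note \<mu> = family_prob_space[OF \<theta>]
  have "AE x in P \<theta>. \<forall>S\<in>marginal_indices d. 0 < m S \<theta> (restrict x S)"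
    by (rule AE_finite_allI[OF finite_marginal_indices])
      (rule marginal_pdf_AE_pos[OF \<mu> family_marginal[OF \<theta>]])
  moreover have "AE x in P \<theta>. \<forall>T\<in>conditional_indices d.
      0 < c T \<theta> (restrict x (fst T)) (restrict x (snd T))"
  proof (rule AE_finite_allI[OF finite_conditional_indices])
    fix T assume "T \<in> conditional_indices d"
    then obtain A B where T: "T = (A, B)" and AB: "(A, B) \<in> conditional_indices d"
      by (cases T) auto
    note AB' = conditional_indices_marginal[OF AB]
    show "AE x in P \<theta>. 0 < c T \<theta> (restrict x (fst T)) (restrict x (snd T))"
      using conditional_pdf_AE_eq[OF \<mu> family_marginal[OF \<theta> AB'(6)] family_marginal[OF \<theta> AB'(5)]
          family_conditional[OF \<theta> AB]]
      by eventually_elim (simp add: T)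
  qed
  ultimately show ?thesis
    by eventually_elim
      (auto simp: composite_likelihood_def split_beta intro!: mult_pos_pos prod_pos pow01_pos)
qed

lemma composite_likelihood_ratio_nn_integral_le:
  assumes \<theta>: "\<theta> \<in> \<Theta>" "\<theta>' \<in> \<Theta>"
    and \<alpha>: "\<And>S. S \<in> marginal_indices d \<Longrightarrow> 0 \<le> \<alpha> S"
    and \<beta>: "\<And>T. T \<in> conditional_indices d \<Longrightarrow> 0 \<le> \<beta> T"
    and pos: "0 < total_weight d \<alpha> \<beta>"
  shows "(\<integral>\<^sup>+x. ennreal (composite_likelihood d \<alpha> \<beta> m c \<theta>' x / composite_likelihood d \<alpha> \<beta> m c \<theta> x)
    \<partial>P \<theta>) \<le> 1"
proof -
  let ?I = "marginal_indices d" and ?J = "conditional_indices d"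
  define u where "u S = \<alpha> S / total_weight d \<alpha> \<beta>" for S
  define v where "v T = \<beta> T / total_weight d \<alpha> \<beta>" for T
  define s where "s S x = m S \<theta>' (restrict x S) / m S \<theta> (restrict x S)" for S x
  define t where "t T x = c T \<theta>' (restrict x (fst T)) (restrict x (snd T)) /
    c T \<theta> (restrict x (fst T)) (restrict x (snd T))" for T x
  have u: "0 \<le> u S" if "S \<in> ?I" for S
    using that \<alpha> pos by (simp add: u_def)
  have v: "0 \<le> v T" if "T \<in> ?J" for T
    using that \<beta> pos by (simp add: v_def)
  have uv: "(\<Sum>S\<in>?I. u S) + (\<Sum>T\<in>?J. v T) = 1"
    using pos by (simp add: u_def v_def total_weight_def flip: sum_divide_distrib add_divide_distrib)
  have s: "0 \<le> s S x" if "S \<in> ?I" "x \<in> \<X>" for S x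
    using that \<theta> by (simp add: s_def marginal_nonneg)
  have t: "0 \<le> t T x" if "T \<in> ?J" "x \<in> \<X>" for T x
    using that \<theta> by (cases T) (simp add: t_def conditional_nonneg)
  have [measurable]: "s S \<in> borel_measurable (P \<theta>)" if "S \<in> ?I" for S
    unfolding s_def[abs_def] using that \<theta> by (intro borel_measurable_divide marginal_measurable)
  have [measurable]: "t T \<in> borel_measurable (P \<theta>)" if "T \<in> ?J" for T
    unfolding t_def[abs_def] using that \<theta>
    by (cases T) (auto intro!: borel_measurable_divide conditional_measurable)
  have s_int: "(\<integral>\<^sup>+x. ennreal (s S x) \<partial>P \<theta>) \<le> 1" if "S \<in> ?I" for S
    unfolding s_def using family_marginal[OF \<theta>(1) that] family_marginal[OF \<theta>(2) that]
    by (intro marginal_ratio_nn_integral_le) (simp_all add: is_marginal_pdf_def)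
  have t_int: "(\<integral>\<^sup>+x. ennreal (t T x) \<partial>P \<theta>) \<le> 1" if T_in: "T \<in> ?J" for T
  proof -
    obtain A B where T: "T = (A, B)" and AB: "(A, B) \<in> ?J"
      using T_in by (cases T) auto
    note AB' = conditional_indices_marginal[OF AB]
    show ?thesis
      unfolding t_def T fst_conv snd_conv
      using family_conditional[OF \<theta>(1) AB] family_conditional[OF \<theta>(2) AB]
      by (intro conditional_ratio_nn_integral_le[OF AB'(1-3) family_prob_space[OF \<theta>(1)]
          family_marginal[OF \<theta>(1) AB'(6)] family_marginal[OF \<theta>(1) AB'(5)]])
        (simp_all add: family_space \<theta>)
  qed
  have "(\<integral>\<^sup>+x. ennreal (composite_likelihood d \<alpha> \<beta> m c \<theta>' x / composite_likelihood d \<alpha> \<beta> m c \<theta> x)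
      \<partial>P \<theta>)
    \<le> (\<integral>\<^sup>+x. (\<Sum>S\<in>?I. ennreal (u S) * ennreal (s S x)) + (\<Sum>T\<in>?J. ennreal (v T) * ennreal (t T x)) \<partial>P \<theta>)"
  proof (rule nn_integral_mono)
    fix x assume "x \<in> space (P \<theta>)"
    then have x: "x \<in> \<X>"
      using family_space[OF \<theta>(1)] by simp
    have "composite_likelihood d \<alpha> \<beta> m c \<theta>' x / composite_likelihood d \<alpha> \<beta> m c \<theta> x
        = (\<Prod>S\<in>?I. pow01 (s S x) (u S)) * (\<Prod>T\<in>?J. pow01 (t T x) (v T))"
    proof -
      have "(\<Prod>S\<in>?I. pow01 (s S x) (u S)) = (\<Prod>S\<in>?I. pow01 (m S \<theta>' (restrict x S)) (u S))
          / (\<Prod>S\<in>?I. pow01 (m S \<theta> (restrict x S)) (u S))"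
        unfolding prod_dividef[symmetric] s_def
        using \<theta> x by (intro prod.cong refl pow01_divide marginal_nonneg)
      moreover have "(\<Prod>T\<in>?J. pow01 (t T x) (v T))
          = (\<Prod>T\<in>?J. pow01 (c T \<theta>' (restrict x (fst T)) (restrict x (snd T))) (v T))
          / (\<Prod>T\<in>?J. pow01 (c T \<theta> (restrict x (fst T)) (restrict x (snd T))) (v T))"
        unfolding prod_dividef[symmetric] t_def
        using \<theta> x by (intro prod.cong refl pow01_divide) (auto intro: conditional_nonneg)
      ultimately show ?thesis
        by (simp add: composite_likelihood_def split_beta u_def v_def)
    qed
    also have "\<dots> \<le> (\<Sum>S\<in>?I. u S * s S x) + (\<Sum>T\<in>?J. v T * t T x)"
      using u v uv s t x
      by (intro weighted_am_gm_Plus finite_marginal_indices finite_conditional_indices) auto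
    finally have "ennreal (composite_likelihood d \<alpha> \<beta> m c \<theta>' x / composite_likelihood d \<alpha> \<beta> m c \<theta> x)
        \<le> ennreal ((\<Sum>S\<in>?I. u S * s S x) + (\<Sum>T\<in>?J. v T * t T x))"
      by (rule ennreal_leI)
    also have "\<dots> = (\<Sum>S\<in>?I. ennreal (u S) * ennreal (s S x)) + (\<Sum>T\<in>?J. ennreal (v T) * ennreal (t T x))"
      using u v s t x by (simp add: ennreal_plus sum_nonneg flip: sum_ennreal ennreal_mult)
    finally show "ennreal (composite_likelihood d \<alpha> \<beta> m c \<theta>' x / composite_likelihood d \<alpha> \<beta> m c \<theta> x)
        \<le> (\<Sum>S\<in>?I. ennreal (u S) * ennreal (s S x)) + (\<Sum>T\<in>?J. ennreal (v T) * ennreal (t T x))" .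
  qed
  also have "\<dots> = (\<Sum>S\<in>?I. ennreal (u S) * (\<integral>\<^sup>+x. ennreal (s S x) \<partial>P \<theta>))
      + (\<Sum>T\<in>?J. ennreal (v T) * (\<integral>\<^sup>+x. ennreal (t T x) \<partial>P \<theta>))"
    by (simp add: nn_integral_add nn_integral_sum nn_integral_cmult)
  also have "\<dots> \<le> (\<Sum>S\<in>?I. ennreal (u S) * 1) + (\<Sum>T\<in>?J. ennreal (v T) * 1)"
    by (intro add_mono sum_mono mult_left_mono s_int t_int) auto
  also have "\<dots> = ennreal ((\<Sum>S\<in>?I. u S) + (\<Sum>T\<in>?J. v T))"
    using u v by (simp add: ennreal_plus sum_nonneg)
  finally show ?thesis
    by (simp add: uv)
qed

end

lemma running_statistic_restrict:
  "running_statistic L \<theta>\<^sub>1 \<theta>\<^sub>0 n (restrict x {1..n}) = running_statistic L \<theta>\<^sub>1 \<theta>\<^sub>0 n x"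
proof -
  have "restrict (restrict x {1..n}) {1..i - 1} = restrict x {1..i - 1}" if "i \<in> {1..n}" for i
    using that by (auto simp: fun_eq_iff)
  then show ?thesis
    unfolding running_statistic_def
    by (intro arg_cong2[where f = "(/)"] prod.cong refl) (auto simp del: One_nat_def)
qed

lemma rejection_time_finite_iff:
  "rejection_time L \<theta>\<^sub>1 \<theta>\<^sub>0 a x < \<infinity> \<longleftrightarrow> (\<exists>n\<ge>1. running_statistic L \<theta>\<^sub>1 \<theta>\<^sub>0 n x > 1 / a)"
  unfolding rejection_time_def Inf_less_iff by auto

theorem proposition3:
  fixes d q :: nat
    and \<X> \<Theta> \<Theta>\<^sub>0 :: "vec set"
    and k :: dist_kind
    and P :: "vec \<Rightarrow> vec measure"
    and m :: "nat set \<Rightarrow> vec \<Rightarrow> vec \<Rightarrow> real"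
    and c :: "nat set \<times> nat set \<Rightarrow> vec \<Rightarrow> vec \<Rightarrow> vec \<Rightarrow> real"
    and \<alpha> :: "nat set \<Rightarrow> real"
    and \<beta> :: "nat set \<times> nat set \<Rightarrow> real"
    and Pr :: "vec \<Rightarrow> 'w measure"
    and X :: "nat \<Rightarrow> 'w \<Rightarrow> vec"
    and \<theta>\<^sub>1 \<theta>\<^sub>0 :: "nat \<Rightarrow> (nat \<Rightarrow> vec) \<Rightarrow> vec"
    and a :: real
  assumes dims: "1 \<le> d" "1 \<le> q"
    and \<X>: "\<X> \<subseteq> space (euclid {1..d})"
    and \<Theta>: "\<Theta> \<subseteq> space (euclid {1..q})"
    and \<Theta>\<^sub>0: "\<Theta>\<^sub>0 \<subseteq> \<Theta>"
    and level: "0 < a" "a < 1"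
    and family: "parametric_family k d \<X> \<Theta> P m c"
    and weights: "\<And>S. S \<in> marginal_indices d \<Longrightarrow> 0 \<le> \<alpha> S"
      "\<And>T. T \<in> conditional_indices d \<Longrightarrow> 0 \<le> \<beta> T"
      "0 < total_weight d \<alpha> \<beta>"
    and data: "\<And>\<theta>. \<theta> \<in> \<Theta> \<Longrightarrow> iid_sample (Pr \<theta>) (sample_space d \<X>) X (P \<theta>)"
    and estimator: "\<And>n. \<theta>\<^sub>1 n \<in> PiM {1..n} (\<lambda>_. sample_space d \<X>) \<rightarrow>\<^sub>M param_space q \<Theta>"
    and mle_measurable:
      "\<And>n. 1 \<le> n \<Longrightarrow> \<theta>\<^sub>0 n \<in> PiM {1..n} (\<lambda>_. sample_space d \<X>) \<rightarrow>\<^sub>M param_space q \<Theta>\<^sub>0"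
    and mle: "\<And>n x. 1 \<le> n \<Longrightarrow> x \<in> {1..n} \<rightarrow>\<^sub>E \<X> \<Longrightarrow>
      is_arg_max (\<lambda>\<theta>. \<Prod>i=1..n. composite_likelihood d \<alpha> \<beta> m c \<theta> (x i)) (\<lambda>\<theta>. \<theta> \<in> \<Theta>\<^sub>0) (\<theta>\<^sub>0 n x)"
    and statistic_measurable: "\<And>n. 1 \<le> n \<Longrightarrow>
      running_statistic (composite_likelihood d \<alpha> \<beta> m c) \<theta>\<^sub>1 \<theta>\<^sub>0 n
        \<in> borel_measurable (PiM {1..n} (\<lambda>_. sample_space d \<X>))"
  shows "(SUP \<theta>\<in>\<Theta>\<^sub>0. measure (Pr \<theta>)
      {\<omega> \<in> space (Pr \<theta>).
        rejection_time (composite_likelihood d \<alpha> \<beta> m c) \<theta>\<^sub>1 \<theta>\<^sub>0 a (\<lambda>i. X i \<omega>) < \<infinity>}) \<le> a"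
proof -
  define L where "L = composite_likelihood d \<alpha> \<beta> m c"
  note space_P = family_space[OF \<X> family]
  have L_nonneg: "0 \<le> L \<theta> x" for \<theta> x
    by (simp add: L_def composite_likelihood_nonneg)
  have space_sample: "space (sample_space d \<X>) = \<X>"
    using \<X> by (auto simp: sample_space_def space_restrict_space)
  have \<theta>\<^sub>1: "\<theta>\<^sub>1 n x \<in> \<Theta>" if "x \<in> {1..n} \<rightarrow>\<^sub>E \<X>" for n x
    using measurable_space[OF estimator, of x n] that
    by (simp add: space_PiM space_sample param_space_def space_restrict_space)
  \<comment> \<open>The supremum over an empty \<open>\<Theta>\<^sub>0\<close> would be an unspecified real, so non-emptiness has to be derived.\<close>
  have "\<theta>\<^sub>1 0 (\<lambda>_. undefined) \<in> \<Theta>"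
    by (rule \<theta>\<^sub>1) simp
  then have "\<X> \<noteq> {}"
    using prob_space.not_empty[OF family_prob_space[OF \<X> family]] space_P by blast
  then obtain y where "y \<in> \<X>"
    by blast
  then have "\<theta>\<^sub>0 1 (\<lambda>i\<in>{1..1}. y) \<in> \<Theta>\<^sub>0"
    using mle[of 1 "\<lambda>i\<in>{1..1}. y"] by (simp add: is_arg_max_def)
  then have "\<Theta>\<^sub>0 \<noteq> {}"
    by blast
  moreover have "measure (Pr \<theta>) {\<omega> \<in> space (Pr \<theta>). rejection_time L \<theta>\<^sub>1 \<theta>\<^sub>0 a (\<lambda>i. X i \<omega>) < \<infinity>} \<le> a"
    if \<theta>\<^sub>0_in: "\<theta> \<in> \<Theta>\<^sub>0" for \<theta>
  proof -
    have \<theta>: "\<theta> \<in> \<Theta>"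
      using \<theta>\<^sub>0_in \<Theta>\<^sub>0 by blast
    note iid = data[OF \<theta>]
    define G where "G = {y \<in> \<X>. 0 < L \<theta> y}"
    define E where "E n = {x \<in> space (PiM {1..n} (\<lambda>_. P \<theta>)). 1 / a < running_statistic L \<theta>\<^sub>1 \<theta>\<^sub>0 n x}" for n
    define r where "r i x y = ennreal (L (\<theta>\<^sub>1 i x) y / L \<theta> y)" for i x y
    have G_sub: "x \<in> I \<rightarrow>\<^sub>E \<X>" if "x \<in> I \<rightarrow>\<^sub>E G" for x and I :: "nat set"
      using that by (auto simp: PiE_iff G_def)
    have sets_eq: "sets (PiM I (\<lambda>_. P \<theta>)) = sets (PiM I (\<lambda>_. sample_space d \<X>))" for I :: "nat set"
      by (intro sets_PiM_cong refl family_sets[OF \<X> family \<theta>])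
    have "emeasure (Pr \<theta>) {\<omega> \<in> space (Pr \<theta>). \<exists>n\<ge>1. restrict (\<lambda>i. X i \<omega>) {1..n} \<in> E n} \<le> ennreal a"
    proof (rule ville_iid_sample[OF iid, where G = G and r = r])
      have "AE y in P \<theta>. 0 < L \<theta> y"
        unfolding L_def by (rule composite_likelihood_AE_pos[OF \<X> family \<theta>])
      then show "AE y in P \<theta>. y \<in> G"
        using AE_space by eventually_elim (simp add: G_def space_P \<theta>)
      show "G \<subseteq> space (P \<theta>)"
        by (auto simp: G_def space_P \<theta>)
    next
      fix n :: nat assume "1 \<le> n"
      then have "running_statistic L \<theta>\<^sub>1 \<theta>\<^sub>0 n \<in> borel_measurable (PiM {1..n} (\<lambda>_. P \<theta>))"
        unfolding L_def measurable_cong_sets[OF sets_eq refl] by (rule statistic_measurable)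
      then show "E n \<in> sets (PiM {1..n} (\<lambda>_. P \<theta>))"
        unfolding E_def by measurable
    next
      fix i x assume "x \<in> {1..i::nat} \<rightarrow>\<^sub>E G"
      then have \<theta>': "\<theta>\<^sub>1 i x \<in> \<Theta>"
        by (intro \<theta>\<^sub>1 G_sub)
      have "L \<eta> \<in> borel_measurable (P \<theta>)" if "\<eta> \<in> \<Theta>" for \<eta>
        unfolding L_def by (rule composite_likelihood_measurable[OF \<X> family that \<theta>])
      from this[OF \<theta>'] this[OF \<theta>] show "r i x \<in> borel_measurable (P \<theta>)"
        unfolding r_def[abs_def] by measurable
      show "(\<integral>\<^sup>+y. r i x y \<partial>P \<theta>) \<le> 1"
        unfolding r_def L_def
        by (rule composite_likelihood_ratio_nn_integral_le[OF \<X> family \<theta> \<theta>' weights])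
    next
      fix n x assume n: "1 \<le> n" and x: "x \<in> {1..n::nat} \<rightarrow>\<^sub>E G" and "x \<in> E n"
      let ?N = "\<Prod>i=1..n. L (\<theta>\<^sub>1 (i - 1) (restrict x {1..i - 1})) (x i)"
      let ?D = "\<Prod>i=1..n. L \<theta> (x i)"
      have D_pos: "0 < ?D"
        using x by (intro prod_pos) (auto simp: PiE_iff G_def)
      have "\<not> (\<Prod>i=1..n. L (\<theta>\<^sub>0 n x) (x i)) < ?D"
        using mle[OF n G_sub[OF x]] \<theta>\<^sub>0_in unfolding is_arg_max_def L_def by blast
      then have D_le: "?D \<le> (\<Prod>i=1..n. L (\<theta>\<^sub>0 n x) (x i))"
        by simp
      have "1 / a < ?N / (\<Prod>i=1..n. L (\<theta>\<^sub>0 n x) (x i))"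
        using \<open>x \<in> E n\<close> PiE_restrict[OF x] by (simp add: E_def running_statistic_def)
      also have "\<dots> \<le> ?N / ?D"
        using D_le D_pos by (intro divide_left_mono prod_nonneg mult_pos_pos) (auto simp: L_nonneg)
      finally have "1 \<le> a * (?N / ?D)"
        using level by (simp add: field_simps)
      also have "?N / ?D = (\<Prod>i=1..n. L (\<theta>\<^sub>1 (i - 1) (restrict x {1..i - 1})) (x i) / L \<theta> (x i))"
        by (simp add: prod_dividef)
      finally have "1 \<le> ennreal (a * (\<Prod>i=1..n. L (\<theta>\<^sub>1 (i - 1) (restrict x {1..i - 1})) (x i) / L \<theta> (x i)))"
        by simp
      also have "\<dots> = ennreal a * (\<Prod>i=1..n. r (i - 1) (restrict x {1..i - 1}) (x i))"
        unfolding r_def using level by (simp add: ennreal_mult prod_nonneg L_nonneg prod_ennreal)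
      finally show "1 \<le> ennreal a * (\<Prod>i=1..n. r (i - 1) (restrict x {1..i - 1}) (x i))" .
    qed
    also have "{\<omega> \<in> space (Pr \<theta>). \<exists>n\<ge>1. restrict (\<lambda>i. X i \<omega>) {1..n} \<in> E n}
      = {\<omega> \<in> space (Pr \<theta>). rejection_time L \<theta>\<^sub>1 \<theta>\<^sub>0 a (\<lambda>i. X i \<omega>) < \<infinity>}"
    proof (intro Collect_cong conj_cong refl)
      fix \<omega> assume \<omega>: "\<omega> \<in> space (Pr \<theta>)"
      have "restrict (\<lambda>i. X i \<omega>) {1..n} \<in> E n \<longleftrightarrow> 1 / a < running_statistic L \<theta>\<^sub>1 \<theta>\<^sub>0 n (\<lambda>i. X i \<omega>)"
        if "1 \<le> n" for n
      proof -
        have "restrict (\<lambda>i. X i \<omega>) {1..n} \<in> space (PiM {1..n} (\<lambda>_. P \<theta>))"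
          using measurable_space[OF iid_sample_law(1)[OF iid that] \<omega>]
          unfolding sets_eq_imp_space_eq[OF sets_eq] .
        then show ?thesis
          unfolding E_def mem_Collect_eq running_statistic_restrict by (simp only: simp_thms)
      qed
      then show "(\<exists>n\<ge>1. restrict (\<lambda>i. X i \<omega>) {1..n} \<in> E n)
          \<longleftrightarrow> rejection_time L \<theta>\<^sub>1 \<theta>\<^sub>0 a (\<lambda>i. X i \<omega>) < \<infinity>"
        unfolding rejection_time_finite_iff by (simp only: cong: conj_cong)
    qed
    finally show ?thesis
      using level by (simp add: measure_def enn2real_leI)
  qed
  ultimately show ?thesis
    unfolding L_def by (intro cSUP_least)
qed

end
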